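(* Let $q$ be a prime power, $\mathbb{F}=\mathbb{F}_q$, $n\ge1$, $i\in[n]$, $a,b\in\mathbb{F}$. Then $|\mathcal{C}^i_{a,b}|=q^{(q-1)q^{n-1}}$ and $|\mathcal{C}^i_{a,*}|=q\,q^{(q-1)q^{n-1}}$; moreover, both as $n\to\infty$ (with $q$ fixed) and as $q\to\infty$ over prime powers (with $n$ fixed), \[ |\mathcal{C}^i_{*,b}|\cong q\,q^{(q-1)q^{n-1}},\quad |\mathcal{C}^*_{a,b}|\cong n\,q^{(q-1)q^{n-1}},\quad |\mathcal{C}^*_{a,*}|\cong nq\,q^{(q-1)q^{n-1}},\quad |\mathcal{C}^*_{*,b}|\cong nq\,q^{(q-1)q^{n-1}}, \] \[ |\mathcal{C}^i_{*,*}|\cong q^2q^{(q-1)q^{n-1}},\quad |\mathcal{C}^*_{*,*}|\cong nq^2q^{(q-1)q^{n-1}}, \] where $F\cong G$ means that the ratio $F/G$ tends to $1$ in the respective limit.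
   Context: $[n]=\{1,\dots,n\}$. For $i\in[n]$ and $a,b\in\mathbb{F}$, $\mathcal{C}^i_{a,b}$ denotes the set of all functions $f:\mathbb{F}^n\to\mathbb{F}$ with $f(x_1,\dots,x_{i-1},a,x_{i+1},\dots,x_n)=b$ for all $(x_1,\dots,x_n)\in\mathbb{F}^n$. A $*$ in place of $i$, $a$ or $b$ denotes the union over all $i\in[n]$, all $a\in\mathbb{F}$ or all $b\in\mathbb{F}$ respectively; e.g. $\mathcal{C}^i_{*,b}=\bigcup_{a}\mathcal{C}^i_{a,b}$, $\mathcal{C}^i_{a,*}=\bigcup_b\mathcal{C}^i_{a,b}$, $\mathcal{C}^*_{a,b}=\bigcup_i\mathcal{C}^i_{a,b}$, $\mathcal{C}^*_{a,*}=\bigcup_i\bigcup_b\mathcal{C}^i_{a,b}$, $\mathcal{C}^*_{*,b}=\bigcup_i\bigcup_a\mathcal{C}^i_{a,b}$, $\mathcal{C}^i_{*,*}=\bigcup_a\bigcup_b\mathcal{C}^i_{a,b}$, $\mathcal{C}^*_{*,*}=\bigcup_i\bigcup_a\bigcup_b\mathcal{C}^i_{a,b}$.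
   Formalization: As q→∞, the asymptotics for |C^i_{*,b}|, |C^*_{*,b}|, |C^i_{*,*}|, |C^*_{*,*}| are stated only for n≥2: for n=1 they fail (|C^1_{*,*}|=q^q against q^{q+1}; |C^1_{*,b}|=q^q-(q-1)^q, ratio 1-1/e). All else is as stated. *)

theory Defs
  imports "HOL-Algebra.Ring" "HOL-Library.FuncSet" "HOL-Library.Landau_Symbols"
begin

definition finite_field :: "('a, 'm) ring_scheme \<Rightarrow> bool" where
  "finite_field K \<longleftrightarrow> field K \<and> finite (carrier K)"

text \<open>The space \<open>F\<^sup>n\<close>: coordinates are indexed by \<open>1, \<dots>, n\<close>, and tuples are extensional
  functions, so that equality of tuples is equality of functions.\<close>

definition points :: "('a, 'm) ring_scheme \<Rightarrow> nat \<Rightarrow> (nat \<Rightarrow> 'a) set" where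
  "points K n = {1..n} \<rightarrow>\<^sub>E carrier K"

text \<open>The set \<open>C\<close> with upper index \<open>i\<close> and lower indices \<open>a, b\<close>. Its members are
  extensional outside \<open>F\<^sup>n\<close>, so \<open>card\<close> counts functions from \<open>F\<^sup>n\<close> to \<open>F\<close>.\<close>

definition canal ::
  "('a, 'm) ring_scheme \<Rightarrow> nat \<Rightarrow> nat \<Rightarrow> 'a \<Rightarrow> 'a \<Rightarrow> ((nat \<Rightarrow> 'a) \<Rightarrow> 'a) set" where
  "canal K n i a b =
     {f \<in> points K n \<rightarrow>\<^sub>E carrier K. \<forall>x\<in>points K n. f (x(i := a)) = b}"

definition base_count :: "nat \<Rightarrow> nat \<Rightarrow> nat" where
  "base_count q n = q ^ ((q - 1) * q ^ (n - 1))"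

text \<open>The limit \<open>q \<rightarrow> \<infinity>\<close> over prime powers: the finite fields \<open>K\<close>, with \<open>q = |K|\<close> tending
  to infinity. The order of a finite field is automatically a prime power.\<close>

definition finite_fields_at_top :: "'a ring filter" where
  "finite_fields_at_top =
     inf (filtercomap (\<lambda>K. card (carrier K)) at_top) (principal {K. finite_field K})"

end

theory Submission
  imports Defs "HOL-Real_Asymp.Real_Asymp"
begin

text \<open>A function lies in the canalizing class of \<open>(i, a, b)\<close> iff it equals \<open>b\<close> on the hyperplane
  \<open>x\<^sub>i = a\<close>, so every class has \<open>N = q ^ ((q - 1) * q ^ (n - 1))\<close> elements. Two hyperplanes leave at
  most \<open>(q - 1)\<^sup>2 * q ^ (n - 2)\<close> points uncovered, whether they are parallel or not, so two
  distinct classes share at most \<open>N / q ^ ((q - 1) * q ^ (n - 2))\<close> functions. By Bonferroni, a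
  union of \<open>m\<close> classes has size \<open>m * N\<close> up to a relative error of
  \<open>m / q ^ ((q - 1) * q ^ (n - 2))\<close>, and \<open>m \<le> n * q\<^sup>2\<close>. For \<open>n = 1\<close> this error estimate is
  unavailable, but there the unions with \<open>a\<close> fixed are disjoint.\<close>

section \<open>Counting tools: prescribed functions and a Bonferroni bound\<close>

lemma finite_field_card_ge_2:
  assumes "finite_field K"
  shows "2 \<le> card (carrier K)"
proof -
  interpret field K using assms by (simp add: finite_field_def)
  have "card {\<zero>\<^bsub>K\<^esub>, \<one>\<^bsub>K\<^esub>} \<le> card (carrier K)"
    using assms by (intro card_mono) (auto simp: finite_field_def)
  then show ?thesis by simp
qed

text \<open>Prescribing \<open>f\<close> on \<open>S\<close> turns the function space into a product
  with singleton factors over \<open>S\<close> and full factors elsewhere. The template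
  \<open>g\<close> need not be constant, so two hyperplanes with different prescribed values are
  covered as well.\<close>

lemma card_PiE_agreeing:
  assumes "finite P" "finite C" "S \<subseteq> P" "g ` S \<subseteq> C"
  shows "card {f \<in> P \<rightarrow>\<^sub>E C. \<forall>x\<in>S. f x = g x} = card C ^ card (P - S)"
proof -
  have "{f \<in> P \<rightarrow>\<^sub>E C. \<forall>x\<in>S. f x = g x} = (\<Pi>\<^sub>E x\<in>P. if x \<in> S then {g x} else C)"
    using assms(3,4) by (fastforce simp: PiE_iff split: if_splits)
  also have "card \<dots> = (\<Prod>x\<in>P. if x \<in> S then 1 else card C)"
    using assms(1) by (subst card_PiE) (auto intro!: prod.cong)
  also have "\<dots> = card C ^ card (P - S)"
    using assms(1) by (simp add: prod.If_cases Diff_eq)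
  finally show ?thesis .
qed

text \<open>Inclusion-exclusion truncated after the pairs. The square of \<open>card I\<close>
  replaces the number of pairs: this is cruder but suits induction, since a new set loses at most
  \<open>card I * e\<close> to the earlier ones.\<close>

lemma card_UN_ge_Bonferroni:
  fixes e :: real
  assumes "finite I" "\<And>i. i \<in> I \<Longrightarrow> finite (A i)"
    and "\<And>i j. i \<in> I \<Longrightarrow> j \<in> I \<Longrightarrow> i \<noteq> j \<Longrightarrow> real (card (A i \<inter> A j)) \<le> e"
    and "0 \<le> e"
  shows "(\<Sum>i\<in>I. real (card (A i))) - real (card I) ^ 2 * e \<le> real (card (\<Union>i\<in>I. A i))"
  using assms
proof (induction I rule: finite_induct)
  case empty
  show ?case by simp
next
  case (insert k I)
  let ?U = "\<Union>i\<in>I. A i"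
  have IH: "(\<Sum>i\<in>I. real (card (A i))) - real (card I) ^ 2 * e \<le> real (card ?U)"
    by (rule insert.IH) (use insert.prems in auto)
  have "card (A k \<inter> ?U) \<le> (\<Sum>i\<in>I. card (A k \<inter> A i))"
    using card_UN_le[OF insert.hyps(1), of "\<lambda>i. A k \<inter> A i"] by simp
  then have "real (card (A k \<inter> ?U)) \<le> (\<Sum>i\<in>I. real (card (A k \<inter> A i)))"
    by (metis of_nat_le_iff of_nat_sum)
  also have "\<dots> \<le> (\<Sum>i\<in>I. e)"
    using insert.hyps insert.prems(2) by (intro sum_mono) auto
  finally have inter: "real (card (A k \<inter> ?U)) \<le> real (card I) * e" by simp
  have "card (A k) + card ?U = card (A k \<union> ?U) + card (A k \<inter> ?U)"
    using insert.hyps insert.prems(1) by (intro card_Un_Int) auto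
  then have union: "real (card (A k)) + real (card ?U)
      = real (card (A k \<union> ?U)) + real (card (A k \<inter> ?U))"
    by (metis of_nat_add)
  \<comment> \<open>With m the size of \<open>I\<close>, the allowance grows by 2me + e, more than
    the loss me bounded in \<open>inter\<close>.\<close>
  have "real (card (insert k I)) ^ 2 * e = real (card I) ^ 2 * e + 2 * (real (card I) * e) + e"
    using insert.hyps by (simp add: power2_eq_square algebra_simps)
  moreover have "0 \<le> real (card I) * e" using \<open>0 \<le> e\<close> by simp
  ultimately show ?case
    using IH inter union \<open>0 \<le> e\<close> insert.hyps by simp
qed

section \<open>Hyperplanes and the points that they leave uncovered\<close>

definition hyperplane :: "('a, 'm) ring_scheme \<Rightarrow> nat \<Rightarrow> nat \<Rightarrow> 'a \<Rightarrow> (nat \<Rightarrow> 'a) set" where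
  "hyperplane K n i a = {x \<in> points K n. x i = a}"

lemma finite_points: "finite (carrier K) \<Longrightarrow> finite (points K n)"
  by (simp add: points_def finite_PiE)

text \<open>The points obtained by substituting \<open>a\<close> for coordinate \<open>i\<close> are
  exactly those of the hyperplane, because substitution fixes each of its points. Membership in a
  class thus becomes a prescription of values on a subset, ready for
  \<open>card_PiE_agreeing\<close>.\<close>

lemma canal_eq_constant_on_hyperplane:
  assumes "i \<in> {1..n}" "a \<in> carrier K"
  shows "canal K n i a b = {f \<in> points K n \<rightarrow>\<^sub>E carrier K. \<forall>x\<in>hyperplane K n i a. f x = b}"
proof -
  have "hyperplane K n i a = (\<lambda>x. x(i := a)) ` points K n"
  proof (intro equalityI subsetI)
    fix x assume "x \<in> hyperplane K n i a"
    then have "x \<in> points K n" "x = x(i := a)" by (auto simp: hyperplane_def)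
    then show "x \<in> (\<lambda>x. x(i := a)) ` points K n" by blast
  qed (use assms in \<open>auto simp: hyperplane_def points_def PiE_iff extensional_def\<close>)
  then show ?thesis by (simp add: canal_def)
qed

lemma hyperplane_nonempty:
  assumes "i \<in> {1..n}" "a \<in> carrier K"
  shows "hyperplane K n i a \<noteq> {}"
proof -
  have "(\<lambda>k\<in>{1..n}. a) \<in> hyperplane K n i a"
    using assms by (auto simp: hyperplane_def points_def)
  then show ?thesis by blast
qed

lemma card_off_hyperplane:
  assumes "finite (carrier K)" "i \<in> {1..n}" "a \<in> carrier K"
  shows "card (points K n - hyperplane K n i a) = (card (carrier K) - 1) * card (carrier K) ^ (n - 1)"
proof -
  have "points K n - hyperplane K n i a
      = (\<Pi>\<^sub>E k\<in>{1..n}. if k = i then carrier K - {a} else carrier K)"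
    using assms by (auto simp: hyperplane_def points_def PiE_iff split: if_splits)
  also have "card \<dots> = (\<Prod>k\<in>{1..n}. if k = i then card (carrier K) - 1 else card (carrier K))"
    using assms by (subst card_PiE) (auto intro!: prod.cong)
  also have "\<dots> = (card (carrier K) - 1) * card (carrier K) ^ (n - 1)"
    using assms by (simp add: prod.remove[of _ i])
  finally show ?thesis .
qed

text \<open>Parallel hyperplanes remove two values from one coordinate, crossing ones remove one
  value from each of two coordinates. The crossing count is the larger, as (q - 1)^2 = (q - 2)q + 1,
  so it bounds both cases.\<close>

lemma card_off_two_hyperplanes_le:
  assumes "finite (carrier K)" "i \<in> {1..n}" "a \<in> carrier K" "j \<in> {1..n}" "c \<in> carrier K"
    and "(i, a) \<noteq> (j, c)" "2 \<le> n"
  shows "card (points K n - (hyperplane K n i a \<union> hyperplane K n j c))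
    \<le> (card (carrier K) - 1) ^ 2 * card (carrier K) ^ (n - 2)"
proof (cases "i = j")
  case True
  let ?q = "card (carrier K)"
  have [simp]: "a \<noteq> c" using True assms by simp
  have "points K n - (hyperplane K n i a \<union> hyperplane K n j c)
      = (\<Pi>\<^sub>E k\<in>{1..n}. if k = i then carrier K - {a, c} else carrier K)"
    using assms True by (auto simp: hyperplane_def points_def PiE_iff split: if_splits)
  also have "card \<dots> = (\<Prod>k\<in>{1..n}. if k = i then ?q - 2 else ?q)"
    using assms by (subst card_PiE) (auto intro!: prod.cong simp: card_Diff_subset)
  also have "\<dots> = (?q - 2) * ?q ^ (n - 1)"
    using assms by (simp add: prod.remove[of _ i])
  also have "\<dots> = ((?q - 2) * ?q) * ?q ^ (n - 2)"
    using \<open>2 \<le> n\<close> by (cases n rule: nat.exhaust) (auto simp: Suc_le_eq gr0_conv_Suc)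
  also have "\<dots> \<le> (?q - 1) ^ 2 * ?q ^ (n - 2)"
  proof (rule mult_right_mono)
    show "(?q - 2) * ?q \<le> (?q - 1) ^ 2"
    \<comment> \<open>For q < 2 truncated subtraction makes the left side 0.\<close>
    proof (cases "?q < 2")
      case False
      then obtain r where "?q = r + 2" by (metis add.commute le_add_diff_inverse not_less)
      then show ?thesis by (simp add: power2_eq_square algebra_simps)
    qed simp
  qed simp
  finally show ?thesis .
next
  case False
  let ?q = "card (carrier K)"
  have "points K n - (hyperplane K n i a \<union> hyperplane K n j c)
      = (\<Pi>\<^sub>E k\<in>{1..n}. if k = i then carrier K - {a} else if k = j then carrier K - {c} else carrier K)"
    using assms False by (auto simp: hyperplane_def points_def PiE_iff split: if_splits)
  also have "card \<dots> = (\<Prod>k\<in>{1..n}. if k = i then ?q - 1 else if k = j then ?q - 1 else ?q)"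
    using assms by (subst card_PiE) (auto intro!: prod.cong)
  also have "\<dots> = (?q - 1) * (\<Prod>k\<in>{1..n} - {i}. if k = j then ?q - 1 else ?q)"
    using assms by (subst prod.remove[of _ i]) auto
  also have "\<dots> = (?q - 1) * ((?q - 1) * ?q ^ (n - 2))"
    using assms False by (subst prod.remove[of _ j]) (auto simp: card_Diff_subset numeral_2_eq_2)
  finally show ?thesis by (simp add: power2_eq_square)
qed

section \<open>Sizes of single classes and of pairwise intersections\<close>

lemma finite_canal: "finite (carrier K) \<Longrightarrow> finite (canal K n i a b)"
  by (rule finite_subset[of _ "points K n \<rightarrow>\<^sub>E carrier K"])
    (auto simp: canal_def finite_PiE finite_points)

lemma card_canal:
  assumes "finite_field K" "i \<in> {1..n}" "a \<in> carrier K" "b \<in> carrier K"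
  shows "card (canal K n i a b) = base_count (card (carrier K)) n"
proof -
  have fin: "finite (carrier K)" using assms by (simp add: finite_field_def)
  have "card (canal K n i a b) = card (carrier K) ^ card (points K n - hyperplane K n i a)"
    unfolding canal_eq_constant_on_hyperplane[OF assms(2,3)]
    using assms fin finite_points[OF fin]
    by (intro card_PiE_agreeing) (auto simp: hyperplane_def)
  then show ?thesis
    using card_off_hyperplane[OF fin assms(2,3)] by (simp add: base_count_def)
qed

text \<open>At any point of the hyperplane a common member would take both values.\<close>

lemma canal_disjoint:
  assumes "i \<in> {1..n}" "a \<in> carrier K" "b \<noteq> d"
  shows "canal K n i a b \<inter> canal K n i a d = {}"
  using hyperplane_nonempty[OF assms(1,2)] assms(3)
  unfolding canal_eq_constant_on_hyperplane[OF assms(1,2)] by auto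

lemma card_UN_canal_values:
  assumes "finite_field K" "i \<in> {1..n}" "a \<in> carrier K"
  shows "card (\<Union>d\<in>carrier K. canal K n i a d) = card (carrier K) * base_count (card (carrier K)) n"
  using assms
  by (subst card_UN_disjoint)
    (auto simp: finite_field_def finite_canal card_canal canal_disjoint)

text \<open>A common member is determined on both hyperplanes, hence free only on the points outside
  them. The bound is stated as a product to stay within the natural numbers.\<close>

lemma card_canal_Int_le:
  assumes K: "finite_field K" and n: "2 \<le> n"
    and ia: "i \<in> {1..n}" "a \<in> carrier K" and b: "b \<in> carrier K"
    and jc: "j \<in> {1..n}" "c \<in> carrier K"
    and neq: "(i, a, b) \<noteq> (j, c, d)"
  defines "q \<equiv> card (carrier K)"
  shows "card (canal K n i a b \<inter> canal K n j c d) * q ^ ((q - 1) * q ^ (n - 2)) \<le> base_count q n"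
proof (cases "canal K n i a b \<inter> canal K n j c d = {}")
  case False
  then obtain g where g: "g \<in> canal K n i a b" "g \<in> canal K n j c d" by blast
  have fin: "finite (carrier K)" using K by (simp add: finite_field_def)
  have q: "2 \<le> q" unfolding q_def by (rule finite_field_card_ge_2[OF K])
  \<comment> \<open>Equal hyperplanes would force \<open>b \<noteq> d\<close>, and then the two
    classes have no common member.\<close>
  have ne: "(i, a) \<noteq> (j, c)" using neq g canal_disjoint[OF ia, of b d] by auto
  let ?S = "hyperplane K n i a \<union> hyperplane K n j c"
  \<comment> \<open>The fixed common member \<open>g\<close> serves as template: it carries the
    value \<open>b\<close> on the first hyperplane and \<open>d\<close> on the second.\<close>
  let ?A = "{f \<in> points K n \<rightarrow>\<^sub>E carrier K. \<forall>x\<in>?S. f x = g x}"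
  have "canal K n i a b \<inter> canal K n j c d \<subseteq> ?A"
    using g unfolding canal_eq_constant_on_hyperplane[OF ia] canal_eq_constant_on_hyperplane[OF jc]
    by auto
  moreover have "finite ?A"
    by (rule finite_subset[of _ "points K n \<rightarrow>\<^sub>E carrier K"])
      (use fin in \<open>auto simp: finite_PiE finite_points\<close>)
  ultimately have "card (canal K n i a b \<inter> canal K n j c d) \<le> card ?A"
    by (intro card_mono)
  also have "card ?A = q ^ card (points K n - ?S)"
    unfolding q_def using g(1) fin
    by (intro card_PiE_agreeing) (auto simp: hyperplane_def finite_points canal_def)
  also have "\<dots> \<le> q ^ ((q - 1) ^ 2 * q ^ (n - 2))"
    using q card_off_two_hyperplanes_le[OF fin ia jc ne n]
    by (intro power_increasing) (auto simp: q_def)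
  finally have "card (canal K n i a b \<inter> canal K n j c d) * q ^ ((q - 1) * q ^ (n - 2))
      \<le> q ^ ((q - 1) ^ 2 * q ^ (n - 2)) * q ^ ((q - 1) * q ^ (n - 2))"
    by (intro mult_right_mono) auto
  also have "\<dots> = q ^ ((q - 1) * q ^ (n - 1))"
  proof -
    obtain r where r: "q = Suc r" using q by (cases q) auto
    obtain m where m: "n = m + 2" using n by (metis add.commute le_add_diff_inverse)
    \<comment> \<open>The exponents fit together because (q - 1)^2 + (q - 1) = (q - 1)q.\<close>
    have "(q - 1) ^ 2 * q ^ (n - 2) + (q - 1) * q ^ (n - 2) = (q - 1) * q ^ (n - 1)"
      by (simp add: r m power2_eq_square algebra_simps)
    then show ?thesis by (simp flip: power_add)
  qed
  finally show ?thesis by (simp add: base_count_def)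
qed simp

section \<open>Unions of classes and their relative error\<close>

definition canal_union ::
  "('a, 'm) ring_scheme \<Rightarrow> nat \<Rightarrow> (nat \<times> 'a \<times> 'a) set \<Rightarrow> ((nat \<Rightarrow> 'a) \<Rightarrow> 'a) set" where
  "canal_union K n I = (\<Union>(i, a, b)\<in>I. canal K n i a b)"

text \<open>Each starred class arises from a product index set whose factors are singletons or full
  ranges, so one estimate for \<open>canal_union\<close> serves them all.\<close>

lemma canal_union_Times:
  "canal_union K n (J \<times> A \<times> B) = (\<Union>j\<in>J. \<Union>a\<in>A. \<Union>b\<in>B. canal K n j a b)"
  by (auto simp: canal_union_def)

text \<open>An upper bound for the relative loss in the Bonferroni estimate: n * q^2 is the number
  of all triples (i, a, b), and the denominator is the factor gained in
  \<open>card_canal_Int_le\<close>.\<close>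

definition overlap_error :: "nat \<Rightarrow> nat \<Rightarrow> real" where
  "overlap_error n q = real n * real q ^ 2 / real q ^ ((q - 1) * q ^ (n - 2))"

text \<open>The upper bound is subadditivity, the lower one Bonferroni. The error depends on
  \<open>n\<close> and \<open>q\<close> only, not on \<open>I\<close>.\<close>

lemma card_canal_union_bounds:
  assumes K: "finite_field K" and n: "2 \<le> n"
    and I: "I \<subseteq> {1..n} \<times> carrier K \<times> carrier K"
  defines "q \<equiv> card (carrier K)"
  defines "g \<equiv> real (card I) * real (base_count q n)"
  shows "g * (1 - overlap_error n q) \<le> real (card (canal_union K n I))"
    and "real (card (canal_union K n I)) \<le> g"
proof -
  have fin: "finite (carrier K)" using K by (simp add: finite_field_def)
  have finI: "finite I" using I by (rule finite_subset) (use fin in auto)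
  have q: "2 \<le> q" unfolding q_def by (rule finite_field_card_ge_2[OF K])
  define A where "A = (\<lambda>(i, a, b). canal K n i a b)"
  define E where "E = real q ^ ((q - 1) * q ^ (n - 2))"
  have U: "canal_union K n I = (\<Union>t\<in>I. A t)" by (simp add: canal_union_def A_def)
  have E: "0 < E" using q by (simp add: E_def)
  have cardA: "card (A t) = base_count q n" if "t \<in> I" for t
    using that I K by (auto simp: A_def q_def card_canal)
  have sumA: "(\<Sum>t\<in>I. real (card (A t))) = g"
    by (simp add: cardA g_def)
  have "card (\<Union>t\<in>I. A t) \<le> (\<Sum>t\<in>I. card (A t))" by (rule card_UN_le[OF finI])
  then show "real (card (canal_union K n I)) \<le> g"
    unfolding U sumA[symmetric] by (metis of_nat_le_iff of_nat_sum)
  have "real (card (A s \<inter> A t)) \<le> real (base_count q n) / E" if st: "s \<in> I" "t \<in> I" "s \<noteq> t" for s t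
  proof -
    have "card (A s \<inter> A t) * q ^ ((q - 1) * q ^ (n - 2)) \<le> base_count q n"
      using st I unfolding A_def q_def
      by (cases s, cases t, simp only: prod.case, intro card_canal_Int_le[OF K n]) auto
    then have "real (card (A s \<inter> A t)) * E \<le> real (base_count q n)"
      unfolding E_def by (metis of_nat_le_iff of_nat_mult of_nat_power)
    then show ?thesis using E by (simp add: field_simps)
  qed
  then have "g - real (card I) ^ 2 * (real (base_count q n) / E) \<le> real (card (\<Union>t\<in>I. A t))"
    unfolding sumA[symmetric] using finI E fin
    by (intro card_UN_ge_Bonferroni) (auto simp: A_def finite_canal)
  moreover have "real (card I) ^ 2 * (real (base_count q n) / E) \<le> g * overlap_error n q"
  proof -
    \<comment> \<open>One factor \<open>card I\<close> of the square is absorbed into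
      \<open>g\<close>; the other is bounded by the number of all triples.\<close>
    have "card I \<le> card ({1..n} \<times> carrier K \<times> carrier K)"
      using I fin by (intro card_mono) auto
    then have "card I \<le> n * q ^ 2"
      by (simp add: card_cartesian_product q_def power2_eq_square)
    then have "real (card I) \<le> real n * real q ^ 2"
      by (metis of_nat_le_iff of_nat_mult of_nat_power)
    then have "g * (real (card I) / E) \<le> g * (real n * real q ^ 2 / E)"
      using E by (intro mult_left_mono divide_right_mono) (auto simp: g_def)
    then show ?thesis
      by (simp add: g_def overlap_error_def E_def power2_eq_square field_simps)
  qed
  ultimately show "g * (1 - overlap_error n q) \<le> real (card (canal_union K n I))"
    unfolding U by (simp add: algebra_simps)
qed

text \<open>The ratio is squeezed between 1 minus the error and 1; nonemptiness of
  \<open>I x\<close> keeps its denominator positive. Field, dimension and index set may all vary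
  with \<open>x\<close>, so both limits are instances.\<close>

lemma asymp_equiv_card_canal_union:
  fixes K :: "'x \<Rightarrow> ('a, 'm) ring_scheme"
  assumes "\<forall>\<^sub>F x in F. finite_field (K x) \<and> 2 \<le> n x \<and>
      I x \<subseteq> {1..n x} \<times> carrier (K x) \<times> carrier (K x) \<and> I x \<noteq> {}"
    and error: "((\<lambda>x. overlap_error (n x) (card (carrier (K x)))) \<longlongrightarrow> 0) F"
  shows "(\<lambda>x. real (card (canal_union (K x) (n x) (I x))))
    \<sim>[F] (\<lambda>x. real (card (I x)) * real (base_count (card (carrier (K x))) (n x)))"
proof (rule asymp_equivI')
  let ?e = "\<lambda>x. overlap_error (n x) (card (carrier (K x)))"
  let ?u = "\<lambda>x. real (card (canal_union (K x) (n x) (I x)))"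
  let ?g = "\<lambda>x. real (card (I x)) * real (base_count (card (carrier (K x))) (n x))"
  have bounds: "\<forall>\<^sub>F x in F. 1 - ?e x \<le> ?u x / ?g x \<and> ?u x / ?g x \<le> 1"
    using assms(1)
  proof eventually_elim
    case (elim x)
    then have "finite (I x)"
      by (intro finite_subset[of "I x" "{1..n x} \<times> carrier (K x) \<times> carrier (K x)"])
        (auto simp: finite_field_def)
    moreover have "2 \<le> card (carrier (K x))" using elim finite_field_card_ge_2 by blast
    ultimately have "0 < ?g x"
      using elim by (intro mult_pos_pos) (auto simp: base_count_def card_gt_0_iff finite_field_def)
    with card_canal_union_bounds[of "K x" "n x" "I x"] elim show ?case
      by (simp add: pos_le_divide_eq pos_divide_le_eq mult.commute)
  qed
  have "((\<lambda>x. 1 - ?e x) \<longlongrightarrow> 1) F"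
    using tendsto_diff[OF tendsto_const error, of 1] by simp
  then show "((\<lambda>x. ?u x / ?g x) \<longlongrightarrow> 1) F"
    by (rule tendsto_sandwich[rotated 2, OF _ tendsto_const])
      (use bounds in \<open>auto elim: eventually_mono\<close>)
qed

section \<open>Decay of the error in either limit\<close>

lemma overlap_error_nonneg: "0 \<le> overlap_error n q"
  by (simp add: overlap_error_def)

text \<open>The denominator grows doubly exponentially in \<open>n\<close>, but the single
  exponential 2^(n - 2) already beats the linear numerator.\<close>

lemma overlap_error_tendsto_dim:
  assumes "2 \<le> q"
  shows "((\<lambda>n. overlap_error n q) \<longlongrightarrow> 0) at_top"
proof (rule tendsto_sandwich[OF _ _ tendsto_const])
  show "\<forall>\<^sub>F n in at_top. 0 \<le> overlap_error n q"
    by (simp add: overlap_error_nonneg)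
  show "\<forall>\<^sub>F n in at_top. overlap_error n q \<le> real n * real q ^ 2 / 2 ^ (n - 2)"
  proof (rule always_eventually, rule allI)
    fix n
    have "n - 2 < 2 ^ (n - 2)" by (rule less_exp)
    also have "(2::nat) ^ (n - 2) \<le> q ^ (n - 2)" using assms by (rule power_mono) simp
    also have "\<dots> \<le> (q - 1) * q ^ (n - 2)" using assms by simp
    finally have "(2::real) ^ (n - 2) \<le> 2 ^ ((q - 1) * q ^ (n - 2))"
      by (intro power_increasing) auto
    also have "\<dots> \<le> real q ^ ((q - 1) * q ^ (n - 2))"
      using assms by (intro power_mono) auto
    finally show "overlap_error n q \<le> real n * real q ^ 2 / 2 ^ (n - 2)"
      unfolding overlap_error_def by (intro divide_left_mono) (use assms in auto)
  qed
  show "((\<lambda>n. real n * real q ^ 2 / 2 ^ (n - 2)) \<longlongrightarrow> 0) at_top"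
  \<comment> \<open>The shift by 2 removes the truncated subtraction.\<close>
  proof (rule LIMSEQ_offset[of _ 2])
    show "(\<lambda>n. real (n + 2) * real q ^ 2 / 2 ^ (n + 2 - 2)) \<longlonglongrightarrow> 0"
      by simp real_asymp
  qed
qed

text \<open>The exponent is at least q - 1 for every \<open>n\<close>: when n < 2, truncated
  subtraction makes the factor \<open>q ^ (n - 2)\<close> equal to 1.\<close>

lemma overlap_error_tendsto_order: "((\<lambda>q. overlap_error n q) \<longlongrightarrow> 0) at_top"
proof (rule tendsto_sandwich[OF _ _ tendsto_const])
  show "\<forall>\<^sub>F q in at_top. 0 \<le> overlap_error n q"
    by (simp add: overlap_error_nonneg)
  show "\<forall>\<^sub>F q in at_top. overlap_error n q \<le> real n * real q ^ 2 / 2 ^ (q - 1)"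
    using eventually_ge_at_top[of 2]
  proof eventually_elim
    case (elim q)
    then have "q - 1 \<le> (q - 1) * q ^ (n - 2)" by simp
    then have "(2::real) ^ (q - 1) \<le> 2 ^ ((q - 1) * q ^ (n - 2))"
      by (intro power_increasing) auto
    also have "\<dots> \<le> real q ^ ((q - 1) * q ^ (n - 2))"
      using elim by (intro power_mono) auto
    finally show ?case
      unfolding overlap_error_def by (intro divide_left_mono) (use elim in auto)
  qed
  show "((\<lambda>q. real n * real q ^ 2 / 2 ^ (q - 1)) \<longlongrightarrow> 0) at_top"
  proof (rule LIMSEQ_offset[of _ 1])
    show "(\<lambda>q. real n * real (q + 1) ^ 2 / 2 ^ (q + 1 - 1)) \<longlonglongrightarrow> 0"
      by simp real_asymp
  qed
qed

text \<open>Transfers limits in the number q to limits over finite fields by composition.\<close>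

lemma card_carrier_at_top:
  "filterlim (\<lambda>K :: 'a ring. card (carrier K)) at_top finite_fields_at_top"
  unfolding finite_fields_at_top_def
  by (rule filterlim_mono[OF filterlim_filtercomap order_refl inf_le1])

lemma eventually_finite_field: "\<forall>\<^sub>F K in finite_fields_at_top. finite_field K"
  unfolding finite_fields_at_top_def
  by (rule filter_leD[OF inf_le2]) (simp add: eventually_principal)

text \<open>The index \<open>i\<close> may vary with \<open>n\<close> in the first limit, and
  \<open>a\<close>, \<open>b\<close> vary with the field in the second. Four of the limits over
  fields assume \<open>n \<ge> 2\<close>, since for infinite \<open>'a\<close> they fail at n = 1:
  there q^q - (q - 1)^q functions take the value b somewhere, a share of q^q tending to 1 - 1/e, and
  the class with all indices starred consists of all q^q functions, against the predicted q^(q +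
  1).\<close>

theorem theorem3p19:
  shows
    "(\<forall>(K :: 'a ring) q n i a b.
        finite_field K \<and> card (carrier K) = q \<and> n \<ge> 1 \<and> i \<in> {1..n} \<and>
        a \<in> carrier K \<and> b \<in> carrier K \<longrightarrow>
        card (canal K n i a b) = base_count q n \<and>
        card (\<Union>d\<in>carrier K. canal K n i a d) = q * base_count q n) \<and>
     (\<forall>(K :: 'a ring) q (i :: nat \<Rightarrow> nat) a b.
        finite_field K \<and> card (carrier K) = q \<and> (\<forall>n\<ge>1. i n \<in> {1..n}) \<and>
        a \<in> carrier K \<and> b \<in> carrier K \<longrightarrow>
        (\<lambda>n. real (card (\<Union>c\<in>carrier K. canal K n (i n) c b)))
          \<sim>[at_top] (\<lambda>n. real q * real (base_count q n)) \<and>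
        (\<lambda>n. real (card (\<Union>j\<in>{1..n}. canal K n j a b)))
          \<sim>[at_top] (\<lambda>n. real n * real (base_count q n)) \<and>
        (\<lambda>n. real (card (\<Union>j\<in>{1..n}. \<Union>d\<in>carrier K. canal K n j a d)))
          \<sim>[at_top] (\<lambda>n. real n * real q * real (base_count q n)) \<and>
        (\<lambda>n. real (card (\<Union>j\<in>{1..n}. \<Union>c\<in>carrier K. canal K n j c b)))
          \<sim>[at_top] (\<lambda>n. real n * real q * real (base_count q n)) \<and>
        (\<lambda>n. real (card (\<Union>c\<in>carrier K. \<Union>d\<in>carrier K. canal K n (i n) c d)))
          \<sim>[at_top] (\<lambda>n. real q ^ 2 * real (base_count q n)) \<and>
        (\<lambda>n. real (card (\<Union>j\<in>{1..n}. \<Union>c\<in>carrier K. \<Union>d\<in>carrier K. canal K n j c d)))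
          \<sim>[at_top] (\<lambda>n. real n * real q ^ 2 * real (base_count q n))) \<and>
     (\<forall>n i (a :: 'a ring \<Rightarrow> 'a) (b :: 'a ring \<Rightarrow> 'a).
        n \<ge> 1 \<and> i \<in> {1..n} \<and>
        (\<forall>K. finite_field K \<longrightarrow> a K \<in> carrier K \<and> b K \<in> carrier K) \<longrightarrow>
        (\<lambda>K :: 'a ring. real (card (\<Union>j\<in>{1..n}. canal K n j (a K) (b K))))
          \<sim>[finite_fields_at_top] (\<lambda>K. real n * real (base_count (card (carrier K)) n)) \<and>
        (\<lambda>K :: 'a ring. real (card (\<Union>j\<in>{1..n}. \<Union>d\<in>carrier K. canal K n j (a K) d)))
          \<sim>[finite_fields_at_top] (\<lambda>K. real n * real (card (carrier K)) * real (base_count (card (carrier K)) n)) \<and>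
        (n \<ge> 2 \<longrightarrow>
          (\<lambda>K :: 'a ring. real (card (\<Union>c\<in>carrier K. canal K n i c (b K))))
            \<sim>[finite_fields_at_top] (\<lambda>K. real (card (carrier K)) * real (base_count (card (carrier K)) n)) \<and>
          (\<lambda>K :: 'a ring. real (card (\<Union>j\<in>{1..n}. \<Union>c\<in>carrier K. canal K n j c (b K))))
            \<sim>[finite_fields_at_top] (\<lambda>K. real n * real (card (carrier K)) * real (base_count (card (carrier K)) n)) \<and>
          (\<lambda>K :: 'a ring. real (card (\<Union>c\<in>carrier K. \<Union>d\<in>carrier K. canal K n i c d)))
            \<sim>[finite_fields_at_top] (\<lambda>K. real (card (carrier K)) ^ 2 * real (base_count (card (carrier K)) n)) \<and>
          (\<lambda>K :: 'a ring. real (card (\<Union>j\<in>{1..n}. \<Union>c\<in>carrier K. \<Union>d\<in>carrier K. canal K n j c d)))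
            \<sim>[finite_fields_at_top] (\<lambda>K. real n * real (card (carrier K)) ^ 2 * real (base_count (card (carrier K)) n))))"
proof (intro conjI allI impI; elim conjE)
  fix K :: "'a ring" and q n i :: nat and a b
  assume "finite_field K" "card (carrier K) = q" "i \<in> {1..n}" "a \<in> carrier K" "b \<in> carrier K"
  then show "card (canal K n i a b) = base_count q n"
    and "card (\<Union>d\<in>carrier K. canal K n i a d) = q * base_count q n"
    by (auto simp: card_canal card_UN_canal_values)
next
  fix K :: "'a ring" and q :: nat and i :: "nat \<Rightarrow> nat" and a b
  assume K: "finite_field K" and q: "card (carrier K) = q" and i: "\<forall>n\<ge>1. i n \<in> {1..n}"
    and ab: "a \<in> carrier K" "b \<in> carrier K"
  have ne: "carrier K \<noteq> {}" using ab by blast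
  have "((\<lambda>n. overlap_error n (card (carrier K))) \<longlongrightarrow> 0) at_top"
    using K by (intro overlap_error_tendsto_dim finite_field_card_ge_2)
  \<comment> \<open>The coordinate set \<open>J n\<close> depends on \<open>n\<close> to allow both
    \<open>{i n}\<close> and \<open>{1..n}\<close>; it is constrained only for
    \<open>2 \<le> n\<close>, which suffices for the limit.\<close>
  then have *: "(\<lambda>n. real (card (canal_union K n (J n \<times> A \<times> B))))
      \<sim>[at_top] (\<lambda>n. real (card (J n \<times> A \<times> B)) * real (base_count q n))"
    if "\<And>n. 2 \<le> n \<Longrightarrow> J n \<subseteq> {1..n} \<and> J n \<noteq> {}" "A \<subseteq> carrier K" "A \<noteq> {}" "B \<subseteq> carrier K" "B \<noteq> {}"
    for J A B
    unfolding q[symmetric] using K that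
    by (intro asymp_equiv_card_canal_union eventually_mono[OF eventually_ge_at_top[of 2]]) auto
  have i': "{i n} \<subseteq> {1..n} \<and> {i n} \<noteq> {}" if "2 \<le> n" for n using i that by auto
  note * = *[unfolded canal_union_Times card_cartesian_product of_nat_mult q]
  note simps = power2_eq_square mult.assoc
  show "(\<lambda>n. real (card (\<Union>c\<in>carrier K. canal K n (i n) c b)))
      \<sim>[at_top] (\<lambda>n. real q * real (base_count q n))"
    using *[of "\<lambda>n. {i n}" "carrier K" "{b}"] i' ab ne by (simp add: simps q)
  show "(\<lambda>n. real (card (\<Union>j\<in>{1..n}. canal K n j a b)))
      \<sim>[at_top] (\<lambda>n. real n * real (base_count q n))"
    using *[of "\<lambda>n. {1..n}" "{a}" "{b}"] ab by (simp add: simps q)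
  show "(\<lambda>n. real (card (\<Union>j\<in>{1..n}. \<Union>d\<in>carrier K. canal K n j a d)))
      \<sim>[at_top] (\<lambda>n. real n * real q * real (base_count q n))"
    using *[of "\<lambda>n. {1..n}" "{a}" "carrier K"] ab ne by (simp add: simps q)
  show "(\<lambda>n. real (card (\<Union>j\<in>{1..n}. \<Union>c\<in>carrier K. canal K n j c b)))
      \<sim>[at_top] (\<lambda>n. real n * real q * real (base_count q n))"
    using *[of "\<lambda>n. {1..n}" "carrier K" "{b}"] ab ne by (simp add: simps q)
  show "(\<lambda>n. real (card (\<Union>c\<in>carrier K. \<Union>d\<in>carrier K. canal K n (i n) c d)))
      \<sim>[at_top] (\<lambda>n. real q ^ 2 * real (base_count q n))"
    using *[of "\<lambda>n. {i n}" "carrier K" "carrier K"] i' ne by (simp add: simps q)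
  show "(\<lambda>n. real (card (\<Union>j\<in>{1..n}. \<Union>c\<in>carrier K. \<Union>d\<in>carrier K. canal K n j c d)))
      \<sim>[at_top] (\<lambda>n. real n * real q ^ 2 * real (base_count q n))"
    using *[of "\<lambda>n. {1..n}" "carrier K" "carrier K"] ne by (simp add: simps q)
next
  fix n i :: nat and a b :: "'a ring \<Rightarrow> 'a"
  assume n: "1 \<le> n" and i: "i \<in> {1..n}"
    and ab: "\<forall>K. finite_field K \<longrightarrow> a K \<in> carrier K \<and> b K \<in> carrier K"
  have "((\<lambda>K :: 'a ring. overlap_error n (card (carrier K))) \<longlongrightarrow> 0) finite_fields_at_top"
    by (rule filterlim_compose[OF overlap_error_tendsto_order card_carrier_at_top])
  then have *: "(\<lambda>K. real (card (canal_union K n (J \<times> A K \<times> B K))))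
      \<sim>[finite_fields_at_top]
        (\<lambda>K. real (card (J \<times> A K \<times> B K)) * real (base_count (card (carrier K)) n))"
    if "2 \<le> n" "J \<subseteq> {1..n}" "J \<noteq> {}"
      "\<And>K. finite_field K \<Longrightarrow> A K \<subseteq> carrier K \<and> A K \<noteq> {} \<and> B K \<subseteq> carrier K \<and> B K \<noteq> {}"
    for J and A B :: "'a ring \<Rightarrow> 'a set"
  proof (rule asymp_equiv_card_canal_union[rotated])
    show "\<forall>\<^sub>F K in finite_fields_at_top. finite_field K \<and> 2 \<le> n \<and>
        J \<times> A K \<times> B K \<subseteq> {1..n} \<times> carrier K \<times> carrier K \<and> J \<times> A K \<times> B K \<noteq> {}"
      using eventually_finite_field by eventually_elim (use that in blast)
  qed
  have ne: "carrier K \<noteq> {}" if "finite_field K" for K :: "'a ring" using ab that by blast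
  note * = *[unfolded canal_union_Times card_cartesian_product of_nat_mult]
  note simps = power2_eq_square mult.assoc
  show "(\<lambda>K :: 'a ring. real (card (\<Union>j\<in>{1..n}. canal K n j (a K) (b K))))
      \<sim>[finite_fields_at_top] (\<lambda>K. real n * real (base_count (card (carrier K)) n))"
  \<comment> \<open>For n = 1 the union is a single class, so the two sides agree for every finite
    field.\<close>
  proof (cases "n = 1")
    case True
    show ?thesis
      by (rule asymp_equiv_refl_ev, rule eventually_mono[OF eventually_finite_field])
        (use True ab in \<open>auto simp: card_canal\<close>)
  next
    case False
    with n ab show ?thesis
      using *[of "{1..n}" "\<lambda>K. {a K}" "\<lambda>K. {b K}"] by (simp add: simps)
  qed
  show "(\<lambda>K :: 'a ring. real (card (\<Union>j\<in>{1..n}. \<Union>d\<in>carrier K. canal K n j (a K) d)))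
      \<sim>[finite_fields_at_top]
        (\<lambda>K. real n * real (card (carrier K)) * real (base_count (card (carrier K)) n))"
  \<comment> \<open>For n = 1 there is one hyperplane, and its classes for different values are
    disjoint, so the count is exact.\<close>
  proof (cases "n = 1")
    case True
    show ?thesis
      by (rule asymp_equiv_refl_ev, rule eventually_mono[OF eventually_finite_field])
        (use True ab in \<open>auto simp: card_UN_canal_values\<close>)
  next
    case False
    with n ab ne show ?thesis
      using *[of "{1..n}" "\<lambda>K. {a K}" carrier] by (simp add: simps)
  qed
  assume n: "2 \<le> n"
  show "(\<lambda>K :: 'a ring. real (card (\<Union>c\<in>carrier K. canal K n i c (b K))))
      \<sim>[finite_fields_at_top]
        (\<lambda>K. real (card (carrier K)) * real (base_count (card (carrier K)) n))"
    using *[of "{i}" carrier "\<lambda>K. {b K}"] n i ab ne by (simp add: simps)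
  show "(\<lambda>K :: 'a ring. real (card (\<Union>j\<in>{1..n}. \<Union>c\<in>carrier K. canal K n j c (b K))))
      \<sim>[finite_fields_at_top]
        (\<lambda>K. real n * real (card (carrier K)) * real (base_count (card (carrier K)) n))"
    using *[of "{1..n}" carrier "\<lambda>K. {b K}"] n ab ne by (simp add: simps)
  show "(\<lambda>K :: 'a ring. real (card (\<Union>c\<in>carrier K. \<Union>d\<in>carrier K. canal K n i c d)))
      \<sim>[finite_fields_at_top]
        (\<lambda>K. real (card (carrier K)) ^ 2 * real (base_count (card (carrier K)) n))"
    using *[of "{i}" carrier carrier] n i ne by (simp add: simps)
  show "(\<lambda>K :: 'a ring. real (card (\<Union>j\<in>{1..n}. \<Union>c\<in>carrier K. \<Union>d\<in>carrier K. canal K n j c d)))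
      \<sim>[finite_fields_at_top]
        (\<lambda>K. real n * real (card (carrier K)) ^ 2 * real (base_count (card (carrier K)) n))"
    using *[of "{1..n}" carrier carrier] n ne by (simp add: simps)
qed

end
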